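(* Let $T\in\mathbb{C}^{m\times n}$ be a partial isometry and let $A\in\mathbb{C}^{m\times n}$. Then the following are equivalent: (i) $A$ is $T$-EP; (ii) $AT^*$ is EP and $A=AT^*T$; (iii) $TA^*$ is EP and $A=AT^*T$; (iv) $TA^\dagger$ is EP and $A=AT^*T$.
   Context: $\mathcal{R}(\cdot)$ denotes the range space, $^*$ the conjugate transpose, and $A^\dagger$ the Moore-Penrose inverse of $A$. $T$ is a partial isometry if $T=TT^*T$. A square matrix $B$ is EP if $\mathcal{R}(B)=\mathcal{R}(B^* )$. $A$ is $T$-EP if $\mathcal{R}(A)=\mathcal{R}(TA^*T)$ and $A=AT^*T$. *)

theory Defs
  imports "HOL-Analysis.Analysis"
begin

text \<open>A complex \<open>m \<times> n\<close> matrix has type \<^typ>\<open>complex^'n^'m\<close>; its entry in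
  row \<open>i\<close> and column \<open>j\<close> is \<open>A $ i $ j\<close>.\<close>

definition conj_transpose :: "complex^'n^'m \<Rightarrow> complex^'m^'n"
  where "conj_transpose A = map_matrix cnj (transpose A)"

definition matrix_range :: "complex^'n^'m \<Rightarrow> (complex^'m) set"
  where "matrix_range A = range (\<lambda>x. A *v x)"

definition partial_isometry :: "complex^'n^'m \<Rightarrow> bool"
  where "partial_isometry T \<longleftrightarrow> T = T ** conj_transpose T ** T"

definition EP :: "complex^'k^'k \<Rightarrow> bool"
  where "EP B \<longleftrightarrow> matrix_range B = matrix_range (conj_transpose B)"

definition T_EP :: "complex^'n^'m \<Rightarrow> complex^'n^'m \<Rightarrow> bool"
  where "T_EP T A \<longleftrightarrow>
    matrix_range A = matrix_range (T ** conj_transpose A ** T) \<and>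
    A = A ** conj_transpose T ** T"

text \<open>The four Penrose equations; exactly one \<open>X\<close> satisfies them (see
  \<open>ex1_moore_penrose\<close> below).\<close>

definition is_moore_penrose :: "complex^'n^'m \<Rightarrow> complex^'m^'n \<Rightarrow> bool"
  where "is_moore_penrose A X \<longleftrightarrow>
    A ** X ** A = A \<and>
    X ** A ** X = X \<and>
    conj_transpose (A ** X) = A ** X \<and>
    conj_transpose (X ** A) = X ** A"

definition moore_penrose :: "complex^'n^'m \<Rightarrow> complex^'m^'n"
  where "moore_penrose A = (THE X. is_moore_penrose A X)"

lemma conj_transpose_mult: "conj_transpose (A ** B) = conj_transpose B ** conj_transpose A"
  by (simp add: conj_transpose_def map_matrix_def transpose_def matrix_matrix_mult_def
      vec_eq_iff mult.commute)

lemma conj_transpose_conj_transpose [simp]: "conj_transpose (conj_transpose A) = A"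
  by (simp add: conj_transpose_def map_matrix_def transpose_def)

lemma conj_transpose_diff: "conj_transpose (A - B) = conj_transpose A - conj_transpose B"
  by (simp add: conj_transpose_def map_matrix_def transpose_def vec_eq_iff)

lemma matrix_diff_ldistrib: "A ** (B - C) = A ** B - A ** (C :: complex^'n^'m)"
  by (simp add: matrix_matrix_mult_def vec_eq_iff right_diff_distrib sum_subtractf)

lemma matrix_diff_rdistrib: "(B - C) ** A = B ** A - (C :: complex^'n^'m) ** A"
  by (simp add: matrix_matrix_mult_def vec_eq_iff left_diff_distrib sum_subtractf)

lemma conj_transpose_mult_self_eq_0:
  assumes "conj_transpose A ** A = 0"
  shows "A = 0"
proof -
  have "A $ i $ j = 0" for i j
  proof -
    have "(\<Sum>k\<in>UNIV. cnj (A $ k $ j) * A $ k $ j) = (conj_transpose A ** A) $ j $ j"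
      by (simp add: conj_transpose_def map_matrix_def transpose_def matrix_matrix_mult_def)
    also have "\<dots> = 0" using assms by simp
    finally have "(\<Sum>k\<in>UNIV. complex_of_real ((cmod (A $ k $ j))\<^sup>2)) = 0"
      by (simp add: complex_norm_square[symmetric] mult.commute[of "cnj _"])
    then have "(\<Sum>k\<in>UNIV. (cmod (A $ k $ j))\<^sup>2) = 0"
      by (metis of_real_eq_0_iff of_real_sum)
    then show ?thesis by (simp add: sum_nonneg_eq_0_iff)
  qed
  then show ?thesis by (simp add: vec_eq_iff)
qed

lemma matrix_inner_inverse_exists: "\<exists>G. A ** G ** A = (A :: complex^'n^'m)"
proof -
  obtain g where g: "Vector_Spaces.linear (*s) (*s) g" "\<forall>v\<in>range ((*v) A). A *v g v = v"
    using vec.linear_exists_right_inverse_on[OF matrix_vector_mul_linear_gen vec.subspace_UNIV]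
    by metis
  have "A ** matrix g ** A = A"
    using g by (simp add: matrix_eq matrix_works flip: matrix_vector_mul_assoc)
  then show ?thesis ..
qed

lemma inner_inverse_hermitian_exists:
  "\<exists>X. A ** X ** A = A \<and> conj_transpose (A ** X) = A ** X"
proof -
  let ?S = "conj_transpose A"
  obtain G where G: "(?S ** A) ** G ** (?S ** A) = ?S ** A"
    using matrix_inner_inverse_exists by blast
  define X where "X = G ** ?S"
  let ?D = "A ** X ** A - A"
  have D0: "?S ** ?D = 0"
    using G by (simp add: X_def matrix_diff_ldistrib matrix_mul_assoc)
  have "conj_transpose ?D ** ?D = (conj_transpose (X ** A) - mat 1) ** (?S ** ?D)"
    by (simp add: conj_transpose_diff conj_transpose_mult matrix_diff_rdistrib
        matrix_diff_ldistrib matrix_mul_assoc)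
  also have "\<dots> = 0"
    by (simp only: D0) (simp add: matrix_matrix_mult_def vec_eq_iff)
  finally have "?D = 0" by (rule conj_transpose_mult_self_eq_0)
  then have X: "A ** X ** A = A" by simp
  have "?S = conj_transpose (A ** X ** A)" by (simp only: X)
  then have S: "?S = ?S ** conj_transpose X ** ?S"
    by (simp only: conj_transpose_mult matrix_mul_assoc)
  have "A ** X = A ** G ** ?S"
    by (simp add: X_def matrix_mul_assoc)
  also have "\<dots> = A ** G ** (?S ** conj_transpose X ** ?S)"
    by (simp only: S[symmetric])
  also have "\<dots> = A ** X ** conj_transpose (A ** X)"
    by (simp add: X_def conj_transpose_mult matrix_mul_assoc)
  finally have "A ** X = A ** X ** conj_transpose (A ** X)" .
  then have "conj_transpose (A ** X) = A ** X"
    by (metis conj_transpose_conj_transpose conj_transpose_mult)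
  with X show ?thesis by blast
qed

lemma ex1_moore_penrose: "\<exists>!X. is_moore_penrose A X"
proof (rule ex_ex1I)
  obtain Y where Y: "A ** Y ** A = A" "conj_transpose (A ** Y) = A ** Y"
    using inner_inverse_hermitian_exists by blast
  obtain Z' where Z': "conj_transpose A ** Z' ** conj_transpose A = conj_transpose A"
    "conj_transpose (conj_transpose A ** Z') = conj_transpose A ** Z'"
    using inner_inverse_hermitian_exists by blast
  define Z where "Z = conj_transpose Z'"
  have Z: "A ** Z ** A = A" "conj_transpose (Z ** A) = Z ** A"
    using arg_cong[OF Z'(1), of conj_transpose] arg_cong[OF Z'(2), of conj_transpose]
    by (simp_all add: Z_def conj_transpose_mult matrix_mul_assoc)
  have 1: "A ** (Z ** A ** Y) = A ** Y" "(Z ** A ** Y) ** A = Z ** A"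
    using Z(1) Y(1) by (simp_all add: matrix_mul_assoc) (simp flip: matrix_mul_assoc)
  have "Z ** A ** (Z ** A ** Y) = Z ** (A ** Z ** A) ** Y"
    by (simp add: matrix_mul_assoc)
  then have 2: "Z ** A ** (Z ** A ** Y) = Z ** A ** Y"
    by (simp only: Z(1))
  have "is_moore_penrose A (Z ** A ** Y)"
    unfolding is_moore_penrose_def 1 2 using Y Z by simp
  then show "\<exists>X. is_moore_penrose A X" ..
next
  fix X Y
  assume X: "is_moore_penrose A X" and Y: "is_moore_penrose A Y"
  have "A ** X = conj_transpose (A ** Y ** (A ** X))"
    using X Y by (metis is_moore_penrose_def matrix_mul_assoc)
  also have "\<dots> = A ** X ** (A ** Y)"
    using X Y by (simp add: is_moore_penrose_def conj_transpose_mult[of "A ** Y" "A ** X"])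
  also have "\<dots> = A ** Y"
    using X by (simp add: is_moore_penrose_def matrix_mul_assoc)
  finally have 1: "A ** X = A ** Y" .
  have "X ** A = conj_transpose (X ** A ** (Y ** A))"
    using X Y by (metis is_moore_penrose_def matrix_mul_assoc)
  also have "\<dots> = Y ** A ** (X ** A)"
    using X Y by (simp add: is_moore_penrose_def conj_transpose_mult[of "X ** A" "Y ** A"])
  also have "\<dots> = Y ** A"
    using X by (metis is_moore_penrose_def matrix_mul_assoc)
  finally have 2: "X ** A = Y ** A" .
  show "X = Y"
    using X Y 1 2 by (metis is_moore_penrose_def matrix_mul_assoc)
qed

lemma is_moore_penrose_moore_penrose: "is_moore_penrose A (moore_penrose A)"
  unfolding moore_penrose_def by (rule theI'[OF ex1_moore_penrose])

end

theory Submission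
  imports Defs
begin

text \<open>
  Write \<open>T\<^sup>*\<close> for the conjugate transpose and \<open>R\<close> for the range.  The condition \<open>A = A T\<^sup>* T\<close>
  occurs in all four statements; under it, each of them says that \<open>R(A) = R(T A\<^sup>*)\<close>.

  For \<open>A T\<^sup>*\<close>, and hence for its conjugate transpose \<open>T A\<^sup>*\<close>, this is because right
  multiplication by \<open>T\<^sup>*\<close> can be undone by \<open>T\<close>, so that \<open>R(A T\<^sup>*) = R(A)\<close>.
  For \<open>T A\<^sup>\<dagger>\<close> it is because the Moore-Penrose inverse has the same range as \<open>A\<^sup>*\<close>, which gives
  \<open>R(T A\<^sup>\<dagger>) = R(T A\<^sup>*)\<close>, while its conjugate transpose has the same range as \<open>A\<close> and
  inherits the condition \<open>A = A T\<^sup>* T\<close>, which gives \<open>R((T A\<^sup>\<dagger>)\<^sup>*) = R(A)\<close>.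

  For \<open>T\<close>-EP, that is for \<open>R(A) = R(T A\<^sup>* T)\<close>, the partial isometry enters.  Either
  range equation puts \<open>R(A)\<close> inside \<open>R(T)\<close>, onto which \<open>T T\<^sup>*\<close> projects, so
  \<open>T T\<^sup>* A = A\<close>.  Taking conjugate transposes, \<open>A\<^sup>* T T\<^sup>* = A\<^sup>*\<close>; therefore
  \<open>T A\<^sup>* = (T A\<^sup>* T) T\<^sup>*\<close>, and \<open>T A\<^sup>*\<close> and \<open>T A\<^sup>* T\<close> have the same range.
\<close>

lemma matrix_range_mult: "matrix_range (A ** B) = (*v) A ` matrix_range B"
  by (simp add: matrix_range_def image_image matrix_vector_mul_assoc)

lemma matrix_range_mult_subset: "matrix_range (A ** B) \<subseteq> matrix_range A"
  by (auto simp: matrix_range_def simp flip: matrix_vector_mul_assoc)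

text \<open>A right multiple of a matrix has no larger range, and \<open>A B\<close> and \<open>A = (A B) C\<close> are right
  multiples of each other.\<close>

lemma matrix_range_mult_cancel:
  assumes "A ** B ** C = A"
  shows "matrix_range (A ** B) = matrix_range A"
  by (metis assms matrix_range_mult_subset subset_antisym)

lemma EP_conj_transpose_iff: "EP (conj_transpose B) \<longleftrightarrow> EP B"
  by (auto simp: EP_def)

text \<open>For a partial isometry, \<open>T T\<^sup>*\<close> is a projection onto the range of \<open>T\<close>.\<close>

lemma partial_isometry_fixes_range:
  assumes "partial_isometry T" and "matrix_range A \<subseteq> matrix_range T"
  shows "T ** conj_transpose T ** A = A"
proof -
  have "(T ** conj_transpose T ** A) *v v = A *v v" for v
  proof -
    obtain w where w: "A *v v = T *v w"
      using assms(2) by (auto simp: matrix_range_def)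
    have "(T ** conj_transpose T ** A) *v v = (T ** conj_transpose T) *v (T *v w)"
      by (simp add: w flip: matrix_vector_mul_assoc)
    also have "\<dots> = (T ** conj_transpose T ** T) *v w"
      by (simp add: matrix_vector_mul_assoc)
    also have "\<dots> = A *v v"
      using assms(1) w by (simp add: partial_isometry_def)
    finally show ?thesis .
  qed
  then show ?thesis by (simp add: matrix_eq)
qed

lemma range_eq_partial_isometry_iff:
  assumes T: "partial_isometry T"
  shows "matrix_range A = matrix_range (T ** conj_transpose A ** T) \<longleftrightarrow>
         matrix_range A = matrix_range (T ** conj_transpose A)"
proof (cases "matrix_range A \<subseteq> matrix_range T")
  case True
  then have "T ** conj_transpose T ** A = A"
    by (rule partial_isometry_fixes_range[OF T])
  then have "conj_transpose A ** T ** conj_transpose T = conj_transpose A"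
    by (metis conj_transpose_conj_transpose conj_transpose_mult matrix_mul_assoc)
  then have "T ** conj_transpose A ** T ** conj_transpose T = T ** conj_transpose A"
    by (metis matrix_mul_assoc)
  from matrix_range_mult_cancel[OF this] show ?thesis by simp
next
  \<comment> \<open>Both right-hand ranges lie in the range of \<open>T\<close>, so both equations fail.\<close>
  case False
  then show ?thesis by (metis matrix_mul_assoc matrix_range_mult_subset)
qed

lemma is_moore_penrose_commute: "is_moore_penrose A X \<longleftrightarrow> is_moore_penrose X A"
  by (auto simp: is_moore_penrose_def)

text \<open>Since \<open>X A\<close> is Hermitian, \<open>X = X A X = A\<^sup>* X\<^sup>* X\<close> and \<open>A\<^sup>* = (A X A)\<^sup>* = X A A\<^sup>*\<close>, so each
  range contains the other.\<close>

lemma matrix_range_moore_penrose: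
  assumes "is_moore_penrose A X"
  shows "matrix_range X = matrix_range (conj_transpose A)"
proof
  have "X = conj_transpose A ** (conj_transpose X ** X)"
    using assms unfolding is_moore_penrose_def by (metis conj_transpose_mult matrix_mul_assoc)
  then show "matrix_range X \<subseteq> matrix_range (conj_transpose A)"
    by (metis matrix_range_mult_subset)
next
  have "conj_transpose A = X ** (A ** conj_transpose A)"
    using assms unfolding is_moore_penrose_def by (metis conj_transpose_mult matrix_mul_assoc)
  then show "matrix_range (conj_transpose A) \<subseteq> matrix_range X"
    by (metis matrix_range_mult_subset)
qed

text \<open>Taking conjugate transposes in \<open>X = X A X\<close> gives \<open>X\<^sup>* = X\<^sup>* X A\<close>, because \<open>X A\<close> is Hermitian:
  whatever acts as the identity to the right of \<open>A\<close> does so to the right of \<open>X\<^sup>*\<close>.\<close>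

lemma conj_transpose_moore_penrose_absorbs:
  assumes "is_moore_penrose A X" and "A ** P = A"
  shows "conj_transpose X ** P = conj_transpose X"
proof -
  have "conj_transpose X = conj_transpose X ** X ** A"
    using assms(1) unfolding is_moore_penrose_def by (metis conj_transpose_mult matrix_mul_assoc)
  then show ?thesis by (metis assms(2) matrix_mul_assoc)
qed

lemma EP_mult_conj_transpose_iff:
  assumes "A ** conj_transpose T ** T = A"
  shows "EP (A ** conj_transpose T) \<longleftrightarrow> matrix_range A = matrix_range (T ** conj_transpose A)"
  by (simp add: EP_def conj_transpose_mult matrix_range_mult_cancel[OF assms])

lemma EP_mult_moore_penrose_iff:
  assumes A: "A ** conj_transpose T ** T = A" and X: "is_moore_penrose A X"
  shows "EP (T ** X) \<longleftrightarrow> matrix_range A = matrix_range (T ** conj_transpose A)"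
proof -
  have "matrix_range (T ** X) = matrix_range (T ** conj_transpose A)"
    by (simp add: matrix_range_mult matrix_range_moore_penrose[OF X])
  moreover have "conj_transpose X ** conj_transpose T ** T = conj_transpose X"
    using conj_transpose_moore_penrose_absorbs[OF X, of "conj_transpose T ** T"] A
    by (simp add: matrix_mul_assoc)
  then have "matrix_range (conj_transpose X ** conj_transpose T) = matrix_range (conj_transpose X)"
    by (rule matrix_range_mult_cancel)
  moreover have "matrix_range (conj_transpose X) = matrix_range A"
    using X matrix_range_moore_penrose is_moore_penrose_commute by blast
  ultimately show ?thesis
    by (auto simp: EP_def conj_transpose_mult)
qed

theorem theorem3p10:
  fixes T A :: "complex^'n^'m"
  assumes "partial_isometry T"
  shows "(T_EP T A \<longleftrightarrow>
            EP (A ** conj_transpose T) \<and> A = A ** conj_transpose T ** T) \<and>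
         (T_EP T A \<longleftrightarrow>
            EP (T ** conj_transpose A) \<and> A = A ** conj_transpose T ** T) \<and>
         (T_EP T A \<longleftrightarrow>
            EP (T ** moore_penrose A) \<and> A = A ** conj_transpose T ** T)"
proof (cases "A ** conj_transpose T ** T = A")
  case True
  have "T_EP T A \<longleftrightarrow> matrix_range A = matrix_range (T ** conj_transpose A)"
    using True range_eq_partial_isometry_iff[OF assms] by (simp add: T_EP_def)
  moreover have "EP (T ** conj_transpose A) \<longleftrightarrow> EP (A ** conj_transpose T)"
    using EP_conj_transpose_iff[of "A ** conj_transpose T"] by (simp add: conj_transpose_mult)
  ultimately show ?thesis
    using True EP_mult_conj_transpose_iff[OF True]
      EP_mult_moore_penrose_iff[OF True is_moore_penrose_moore_penrose]
    by simp
next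
  case False
  then show ?thesis by (auto simp: T_EP_def)
qed

end
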